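(* Let $A$ be a finite-dimensional complex algebra with fixed basis $\{a_1,\dots,a_d\}$, $d=\dim_{\mathbb{C}}A$, and let $M$ and $N$ be finite-dimensional left $A$-modules. Then $M$ and $N$ are isomorphic as $A$-modules if and only if $\int_{I_A(t)}N$ and $\int_{I_A(t)}M$ are similar for all $t\in(\mathbb{R}_{>0})^{d}$ with a transition matrix independent of $t$; that is, if and only if there is an invertible $\mathbb{C}$-linear map $h:M\to N$ such that \[ \Big(\int_{I_A(t)}N\Big)\circ h=h\circ\Big(\int_{I_A(t)}M\Big)\qquad\text{for all } t\in(\mathbb{R}_{>0})^{d}. \]
   Context: Algebras are associative and unital over $\mathbb{C}$. For a finite-dimensional left $A$-module $M$, $\rho_M:A\to\mathrm{End}_{\mathbb{C}}(M)$, $a\mapsto(m\mapsto a.m)$. For $t=(t_1,\dots,t_d)\in(\mathbb{R}_{\ge0})^d$ put $I_A(t)=\{\sum_i\lambda_ia_i:0\le\lambda_i\le t_i\}$, identified with $\prod_i[0,t_i]$ and equipped with the transported $d$-dimensional Lebesgue measure $\mu_t$ (total mass $\prod_it_i$). The parameterized integral of $M$ is $\int_{I_A(t)}M:=\int_{I_A(t)}\rho_M(x)\,d\mu_t(x)\in\mathrm{End}_{\mathbb{C}}(M)$ (vector-valued Bochner integral). *)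

theory Defs
  imports "HOL-Analysis.Analysis"
begin

section \<open>Complex vector spaces and algebras\<close>

class complex_vector = ab_group_add +
  fixes scaleC :: "complex \<Rightarrow> 'a \<Rightarrow> 'a" (infixr "*\<^sub>C" 75)
  assumes scaleC_add_right: "c *\<^sub>C (x + y) = c *\<^sub>C x + c *\<^sub>C y"
    and scaleC_add_left: "(c + c') *\<^sub>C x = c *\<^sub>C x + c' *\<^sub>C x"
    and scaleC_scaleC: "c *\<^sub>C c' *\<^sub>C x = (c * c') *\<^sub>C x"
    and scaleC_one: "1 *\<^sub>C x = x"

global_interpretation complex_vector: vector_space "scaleC :: complex \<Rightarrow> 'a \<Rightarrow> 'a::complex_vector"
  defines cspan = complex_vector.span
    and cdependent = complex_vector.dependent
    and crepresentation = complex_vector.representation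
  by unfold_locales (auto simp: scaleC_add_right scaleC_add_left scaleC_scaleC scaleC_one)

global_interpretation complex_vector: vector_space_pair
    "scaleC :: complex \<Rightarrow> 'a \<Rightarrow> 'a::complex_vector" "scaleC :: complex \<Rightarrow> 'b \<Rightarrow> 'b::complex_vector"
  ..

abbreviation cindependent :: "'a::complex_vector set \<Rightarrow> bool"
  where "cindependent B \<equiv> \<not> cdependent B"

abbreviation clinear :: "('a::complex_vector \<Rightarrow> 'b::complex_vector) \<Rightarrow> bool"
  where "clinear \<equiv> Vector_Spaces.linear (*\<^sub>C) (*\<^sub>C)"

class fd_complex_vector = complex_vector +
  assumes finite_spanning: "\<exists>B. finite B \<and> (\<forall>x. \<exists>u. x = (\<Sum>b\<in>B. u b *\<^sub>C b))"

lemma finite_cspan: "\<exists>B :: 'a::fd_complex_vector set. finite B \<and> cspan B = UNIV"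
proof -
  obtain B :: "'a set" where B: "finite B" "\<And>x. \<exists>u. x = (\<Sum>b\<in>B. u b *\<^sub>C b)"
    using finite_spanning by blast
  have "x \<in> cspan B" for x
    using B(2)[of x] complex_vector.span_finite[OF B(1)] by auto
  then show ?thesis using B(1) by blast
qed

text \<open>
  Unital associative algebras. The unit comes from \<^class>\<open>monoid_mult\<close> rather than \<^class>\<open>ring_1\<close>,
  so that the zero algebra, where \<open>0 = 1\<close>, is included.
\<close>

class complex_algebra = ring + monoid_mult + complex_vector +
  assumes mult_scaleC_left: "(c *\<^sub>C x) * y = c *\<^sub>C (x * y)"
    and mult_scaleC_right: "x * (c *\<^sub>C y) = c *\<^sub>C (x * y)"

definition cbasis :: "nat \<Rightarrow> (nat \<Rightarrow> 'a::complex_vector) \<Rightarrow> bool"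
  where "cbasis d a \<longleftrightarrow>
    inj_on a {..<d} \<and> cindependent (a ` {..<d}) \<and> cspan (a ` {..<d}) = UNIV"


section \<open>The Banach space of endomorphisms of a finite-dimensional space\<close>

text \<open>
  The finite-dimensional space \<open>V\<close> carries no norm, so \<open>End V\<close> is normed by the sum of the absolute
  values of the matrix entries with respect to some basis of \<open>V\<close>. All norms on \<open>End V\<close> are
  equivalent, so neither Bochner integrability nor the value of a Bochner integral depends on
  this choice.
\<close>

typedef (overloaded) 'a cendo = "{f :: 'a::fd_complex_vector \<Rightarrow> 'a. clinear f}"
  morphisms cendo_apply Cendo
  using complex_vector.linear_zero by blast

setup_lifting type_definition_cendo

lemma clinear_cendo_apply: "clinear (cendo_apply f)"
  using cendo_apply by blast

definition some_cbasis :: "'a::fd_complex_vector set"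
  where "some_cbasis = (SOME B. finite B \<and> cindependent B \<and> cspan B = UNIV)"

lemma some_cbasis:
  shows finite_some_cbasis: "finite (some_cbasis :: 'a::fd_complex_vector set)"
    and cindependent_some_cbasis: "cindependent (some_cbasis :: 'a set)"
    and cspan_some_cbasis: "cspan (some_cbasis :: 'a set) = UNIV"
proof -
  obtain B :: "'a set" where B: "finite B" "cspan B = UNIV"
    using finite_cspan by blast
  obtain B' where "B' \<subseteq> B" "cindependent B'" "B \<subseteq> cspan B'"
    using complex_vector.maximal_independent_subset[of B] by blast
  then have "finite B'" "cindependent B'" "cspan B' = UNIV"
    using B complex_vector.span_mono[of B "cspan B'"] finite_subset
    by (auto simp: complex_vector.span_span)
  then have "\<exists>B::'a set. finite B \<and> cindependent B \<and> cspan B = UNIV" by blast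
  from someI_ex[OF this]
  show "finite (some_cbasis :: 'a set)" "cindependent (some_cbasis :: 'a set)"
    "cspan (some_cbasis :: 'a set) = UNIV"
    unfolding some_cbasis_def by auto
qed

definition mentry :: "'a::fd_complex_vector cendo \<Rightarrow> 'a \<times> 'a \<Rightarrow> complex"
  where "mentry f p = crepresentation some_cbasis (cendo_apply f (snd p)) (fst p)"

abbreviation mindex :: "('a::fd_complex_vector \<times> 'a) set"
  where "mindex \<equiv> some_cbasis \<times> some_cbasis"

instantiation cendo :: (fd_complex_vector) real_normed_vector
begin

lift_definition zero_cendo :: "'a cendo" is "\<lambda>x. 0"
  by (rule complex_vector.linear_zero)

lift_definition plus_cendo :: "'a cendo \<Rightarrow> 'a cendo \<Rightarrow> 'a cendo" is "\<lambda>f g x. f x + g x"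
  by (rule complex_vector.linear_compose_add)

lift_definition minus_cendo :: "'a cendo \<Rightarrow> 'a cendo \<Rightarrow> 'a cendo" is "\<lambda>f g x. f x - g x"
  by (rule complex_vector.linear_compose_sub)

lift_definition uminus_cendo :: "'a cendo \<Rightarrow> 'a cendo" is "\<lambda>f x. - f x"
  by (rule complex_vector.linear_compose_neg)

lift_definition scaleR_cendo :: "real \<Rightarrow> 'a cendo \<Rightarrow> 'a cendo"
  is "\<lambda>r f x. complex_of_real r *\<^sub>C f x"
  by (rule complex_vector.linear_compose_scale_right)

definition norm_cendo :: "'a cendo \<Rightarrow> real"
  where "norm_cendo f = (\<Sum>p\<in>mindex. cmod (mentry f p))"

definition dist_cendo :: "'a cendo \<Rightarrow> 'a cendo \<Rightarrow> real"
  where "dist_cendo f g = norm (f - g)"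

definition uniformity_cendo :: "('a cendo \<times> 'a cendo) filter"
  where "uniformity_cendo = (INF e\<in>{0<..}. principal {(x, y). dist x y < e})"

definition open_cendo :: "'a cendo set \<Rightarrow> bool"
  where "open_cendo S = (\<forall>x\<in>S. \<forall>\<^sub>F (x', y) in uniformity. x' = x \<longrightarrow> y \<in> S)"

definition sgn_cendo :: "'a cendo \<Rightarrow> 'a cendo"
  where "sgn_cendo f = inverse (norm f) *\<^sub>R f"

lemma mentry_add: "mentry (f + g) p = mentry f p + mentry g p"
  unfolding mentry_def
  by (simp add: plus_cendo.rep_eq complex_vector.representation_add
      cindependent_some_cbasis cspan_some_cbasis)

lemma mentry_scaleR: "mentry (r *\<^sub>R f) p = of_real r * mentry f p"
  unfolding mentry_def
  by (simp add: scaleR_cendo.rep_eq complex_vector.representation_scale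
      cindependent_some_cbasis cspan_some_cbasis)

lemma mentry_0: "mentry 0 p = 0"
  unfolding mentry_def by (simp add: zero_cendo.rep_eq complex_vector.representation_zero)

lemma mentry_diff: "mentry (f - g) p = mentry f p - mentry g p"
  unfolding mentry_def
  by (simp add: minus_cendo.rep_eq complex_vector.representation_diff
      cindependent_some_cbasis cspan_some_cbasis)

lemma mentry_eqI:
  fixes f g :: "'a cendo"
  assumes "\<And>p. p \<in> mindex \<Longrightarrow> mentry f p = mentry g p"
  shows "f = g"
proof -
  have "cendo_apply f b = cendo_apply g b" if b: "b \<in> some_cbasis" for b
  proof -
    have "cendo_apply f b = (\<Sum>b'\<in>some_cbasis. mentry f (b', b) *\<^sub>C b')" for f :: "'a cendo"
      unfolding mentry_def
      by (simp add: complex_vector.sum_representation_eq finite_some_cbasis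
          cindependent_some_cbasis cspan_some_cbasis)
    then show ?thesis using assms b by simp
  qed
  then have "cendo_apply f x = cendo_apply g x" for x
    using complex_vector.linear_eq_on[OF clinear_cendo_apply[of f] clinear_cendo_apply[of g],
        of x some_cbasis] by (simp add: cspan_some_cbasis)
  then show ?thesis by (metis cendo_apply_inject ext)
qed

instance
proof
  fix f g :: "'a cendo" and r s :: real
  show "r *\<^sub>R (f + g) = r *\<^sub>R f + r *\<^sub>R g"
    by transfer (simp add: scaleC_add_right)
  show "(r + s) *\<^sub>R f = r *\<^sub>R f + s *\<^sub>R f"
    by transfer (simp add: scaleC_add_left)
  show "r *\<^sub>R s *\<^sub>R f = (r * s) *\<^sub>R f"
    by transfer (simp add: scaleC_scaleC)
  show "1 *\<^sub>R f = f"
    by transfer (simp add: scaleC_one)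
  show "dist f g = norm (f - g)" by (rule dist_cendo_def)
  show "sgn f = inverse (norm f) *\<^sub>R f" by (rule sgn_cendo_def)
  show "(uniformity :: ('a cendo \<times> 'a cendo) filter) =
    (INF e\<in>{0<..}. principal {(x, y). dist x y < e})" by (rule uniformity_cendo_def)
  show "open S = (\<forall>x\<in>S. \<forall>\<^sub>F (x', y) in uniformity. x' = x \<longrightarrow> y \<in> S)" for S :: "'a cendo set"
    by (rule open_cendo_def)
  show "norm f = 0 \<longleftrightarrow> f = 0"
  proof
    assume "norm f = 0"
    then have "\<forall>p\<in>mindex. cmod (mentry f p) = 0"
      unfolding norm_cendo_def
      by (subst (asm) sum_nonneg_eq_0_iff) (auto simp: finite_some_cbasis)
    then show "f = 0" by (intro mentry_eqI) (auto simp: mentry_0)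
  qed (simp add: norm_cendo_def mentry_0)
  show "norm (f + g) \<le> norm f + norm g"
    unfolding norm_cendo_def mentry_add sum.distrib[symmetric]
    by (intro sum_mono norm_triangle_ineq)
  show "norm (r *\<^sub>R f) = \<bar>r\<bar> * norm f"
    unfolding norm_cendo_def mentry_scaleR by (simp add: norm_mult sum_distrib_left)
qed (transfer; simp add: add_ac)+

end

lemma cmod_mentry_le:
  assumes "p \<in> mindex"
  shows "cmod (mentry f p) \<le> norm f"
  unfolding norm_cendo_def
  using assms by (intro member_le_sum) (auto simp: finite_some_cbasis)

lemma bounded_linear_mentry:
  assumes "p \<in> mindex"
  shows "bounded_linear (\<lambda>f. mentry f p)"
  by (rule bounded_linear_intro[where K = 1])
    (auto simp: mentry_add mentry_scaleR scaleR_conv_of_real cmod_mentry_le[OF assms])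

lemma ex_mentry:
  fixes X :: "'a::fd_complex_vector \<times> 'a \<Rightarrow> complex"
  shows "\<exists>f. \<forall>p\<in>mindex. mentry f p = X p"
proof -
  define g where "g b = (\<Sum>b'\<in>some_cbasis. X (b', b) *\<^sub>C b')" for b
  obtain f where f: "clinear f" "\<forall>b\<in>some_cbasis. f b = g b"
    using complex_vector.linear_independent_extend[OF cindependent_some_cbasis, of g] by blast
  have "mentry (Cendo f) (b', b) = X (b', b)"
    if "b' \<in> some_cbasis" "b \<in> some_cbasis" for b' b
  proof -
    have "crepresentation some_cbasis (g b) =
        (\<lambda>b'. if b' \<in> some_cbasis then X (b', b) else 0)" (is "_ = ?r")
    proof (rule complex_vector.representation_eqI)
      show fin: "finite {b'. ?r b' \<noteq> 0}"
        by (rule finite_subset[OF _ finite_some_cbasis]) auto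
      show "(\<Sum>b' | ?r b' \<noteq> 0. ?r b' *\<^sub>C b') = g b"
        unfolding g_def
        by (rule sum.mono_neutral_cong_left) (auto simp: finite_some_cbasis)
    qed (auto simp: cindependent_some_cbasis cspan_some_cbasis split: if_splits)
    then show ?thesis
      using f that by (simp add: mentry_def Cendo_inverse)
  qed
  then show ?thesis by auto
qed

instance cendo :: (fd_complex_vector) banach
proof
  fix F :: "nat \<Rightarrow> 'a cendo"
  assume F: "Cauchy F"
  have "convergent (\<lambda>n. mentry (F n) p)" if "p \<in> mindex" for p
    using bounded_linear.Cauchy[OF bounded_linear_mentry[OF that] F]
    by (rule Cauchy_convergent)
  then obtain X where X: "\<And>p. p \<in> mindex \<Longrightarrow> (\<lambda>n. mentry (F n) p) \<longlonglongrightarrow> X p"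
    unfolding convergent_def by metis
  obtain f where f: "\<forall>p\<in>mindex. mentry f p = X p"
    using ex_mentry by blast
  have "(\<lambda>n. \<Sum>p\<in>mindex. cmod (mentry (F n) p - mentry f p)) \<longlonglongrightarrow> (\<Sum>p\<in>(mindex :: ('a \<times> 'a) set). 0)"
    using X by (intro tendsto_sum tendsto_norm_zero LIM_zero) (metis f)
  then have "(\<lambda>n. norm (F n - f)) \<longlonglongrightarrow> 0"
    by (simp add: norm_cendo_def mentry_diff)
  then have "F \<longlonglongrightarrow> f"
    using LIM_zero_cancel tendsto_norm_zero_iff by blast
  then show "convergent F" by (rule convergentI)
qed

instance cendo :: (fd_complex_vector) second_countable_topology
proof
  obtain \<B> :: "complex set set" where \<B>: "countable \<B>" "topological_basis \<B>"
    using ex_countable_basis by blast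
  define C where "C U = {f :: 'a cendo. \<forall>p\<in>mindex. mentry f p \<in> U p}" for U
  define \<C> where "\<C> = C ` (Pi\<^sub>E mindex (\<lambda>_. \<B>))"
  have "countable \<C>"
    unfolding \<C>_def using \<B>(1) by (intro countable_image countable_PiE) (auto simp: finite_some_cbasis)
  moreover have "topological_basis \<C>"
  proof (rule topological_basisI)
    fix V :: "'a cendo set"
    assume "V \<in> \<C>"
    then obtain U where U: "U \<in> Pi\<^sub>E mindex (\<lambda>_. \<B>)" "V = C U"
      unfolding \<C>_def by auto
    have "V = (\<Inter>p\<in>mindex. (\<lambda>f. mentry f p) -` U p)"
      unfolding U(2) C_def by auto
    moreover have "open ((\<lambda>f :: 'a cendo. mentry f p) -` U p)" if "p \<in> mindex" for p
    proof (rule open_vimage)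
      show "open (U p)" using U(1) that topological_basis_open[OF \<B>(2)] by auto
      show "continuous_on UNIV (\<lambda>f :: 'a cendo. mentry f p)"
        by (rule linear_continuous_on[OF bounded_linear_mentry[OF that]])
    qed
    ultimately show "open V" by (auto simp: finite_some_cbasis intro!: open_INT)
  next
    fix S and f :: "'a cendo"
    assume "open S" "f \<in> S"
    then obtain e where e: "e > 0" "ball f e \<subseteq> S"
      using open_contains_ball by blast
    define k where "k = real (card (mindex :: ('a \<times> 'a) set)) + 1"
    have k: "k > 0" unfolding k_def by simp
    have "\<exists>W\<in>\<B>. mentry f p \<in> W \<and> W \<subseteq> ball (mentry f p) (e / k)" for p
      using topological_basisE[OF \<B>(2) open_ball, of "mentry f p" "mentry f p" "e / k"] e k
      by (metis centre_in_ball divide_pos_pos)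
    then obtain U where U: "\<And>p. U p \<in> \<B>" "\<And>p. mentry f p \<in> U p"
      "\<And>p. U p \<subseteq> ball (mentry f p) (e / k)"
      by metis
    have "C (restrict U mindex) \<subseteq> S"
    proof
      fix g assume g: "g \<in> C (restrict U mindex)"
      have "norm (f - g) \<le> (\<Sum>p\<in>(mindex :: ('a \<times> 'a) set). e / k)"
        unfolding norm_cendo_def mentry_diff
      proof (rule sum_mono)
        fix p :: "'a \<times> 'a" assume "p \<in> mindex"
        then have "mentry g p \<in> ball (mentry f p) (e / k)"
          using g U(3)[of p] unfolding C_def by fastforce
        then show "cmod (mentry f p - mentry g p) \<le> e / k" by (simp add: dist_norm)
      qed
      also have "\<dots> = (k - 1) * (e / k)" unfolding k_def by simp
      also have "\<dots> < e" using e k by (simp add: field_simps)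
      finally show "g \<in> S" using e by (auto simp: dist_norm)
    qed
    moreover have "C (restrict U mindex) \<in> \<C>" unfolding \<C>_def using U(1) by auto
    moreover have "f \<in> C (restrict U mindex)" unfolding C_def using U(2) by auto
    ultimately show "\<exists>V\<in>\<C>. f \<in> V \<and> V \<subseteq> S" by blast
  qed
  ultimately show "\<exists>B::'a cendo set set. countable B \<and> open = generate_topology B"
    using topological_basis_imp_subbasis by blast
qed


section \<open>Modules over an algebra\<close>

locale alg_module =
  fixes act :: "'a::complex_algebra \<Rightarrow> 'm::complex_vector \<Rightarrow> 'm"
  assumes act_add_left: "act (x + y) m = act x m + act y m"
    and act_add_right: "act x (m + m') = act x m + act x m'"
    and act_scaleC_left: "act (c *\<^sub>C x) m = c *\<^sub>C act x m"
    and act_scaleC_right: "act x (c *\<^sub>C m) = c *\<^sub>C act x m"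
    and act_mult: "act (x * y) m = act x (act y m)"
    and act_one: "act 1 m = m"

text \<open>An additive map commuting with the actions is complex-linear, since \<open>c *\<^sub>C m = act (c *\<^sub>C 1) m\<close>.\<close>

definition isomorphic_modules ::
  "('a::complex_algebra \<Rightarrow> 'm::complex_vector \<Rightarrow> 'm) \<Rightarrow> ('a \<Rightarrow> 'n::complex_vector \<Rightarrow> 'n) \<Rightarrow> bool"
  where "isomorphic_modules actM actN \<longleftrightarrow>
    (\<exists>h. bij h \<and> (\<forall>m m'. h (m + m') = h m + h m') \<and> (\<forall>x m. h (actM x m) = actN x (h m)))"

definition rho :: "('a::complex_algebra \<Rightarrow> 'm::fd_complex_vector \<Rightarrow> 'm) \<Rightarrow> 'a \<Rightarrow> 'm cendo"
  where "rho act x = Cendo (act x)"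


section \<open>The parameterized integral\<close>

definition lincomb :: "nat \<Rightarrow> (nat \<Rightarrow> 'a::complex_vector) \<Rightarrow> (nat \<Rightarrow> real) \<Rightarrow> 'a"
  where "lincomb d a s = (\<Sum>i<d. complex_of_real (s i) *\<^sub>C a i)"

text \<open>
  Points of \<open>\<real>\<^sup>d\<close> are represented by the functions \<^typ>\<open>nat \<Rightarrow> real\<close> that are \<^term>\<open>undefined\<close> outside
  \<open>{..<d}\<close>, as in \<^const>\<open>PiM\<close>; this allows \<open>d = 0\<close>.
\<close>

definition box_param :: "nat \<Rightarrow> (nat \<Rightarrow> real) \<Rightarrow> (nat \<Rightarrow> real) set"
  where "box_param d t = Pi\<^sub>E {..<d} (\<lambda>i. {0..t i})"

definition I_alg :: "nat \<Rightarrow> (nat \<Rightarrow> 'a::complex_vector) \<Rightarrow> (nat \<Rightarrow> real) \<Rightarrow> 'a set"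
  where "I_alg d a t = {lincomb d a s | s. \<forall>i<d. 0 \<le> s i \<and> s i \<le> t i}"

definition lebesgue_PiM :: "nat \<Rightarrow> (nat \<Rightarrow> real) measure"
  where "lebesgue_PiM d = completion (Pi\<^sub>M {..<d} (\<lambda>_. lborel))"

definition mu_alg :: "nat \<Rightarrow> (nat \<Rightarrow> 'a::complex_vector) \<Rightarrow> (nat \<Rightarrow> real) \<Rightarrow> 'a measure"
  where "mu_alg d a t = embed_measure (restrict_space (lebesgue_PiM d) (box_param d t)) (lincomb d a)"

lemma inj_on_lincomb:
  assumes "cbasis d a"
  shows "inj_on (lincomb d a) (extensional {..<d})"
proof (rule inj_onI)
  fix s s' assume s: "s \<in> extensional {..<d}" "s' \<in> extensional {..<d}"
    and eq: "lincomb d a s = lincomb d a s'"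
  have inj: "inj_on a {..<d}" and ind: "cindependent (a ` {..<d})"
    using assms by (auto simp: cbasis_def)
  define u where "u b = complex_of_real (s (the_inv_into {..<d} a b) - s' (the_inv_into {..<d} a b))" for b
  have u: "u (a i) = complex_of_real (s i - s' i)" if "i < d" for i
    using that inj by (simp add: u_def the_inv_into_f_f)
  have "(\<Sum>b\<in>a ` {..<d}. u b *\<^sub>C b) = (\<Sum>i<d. complex_of_real (s i - s' i) *\<^sub>C a i)"
    by (simp add: sum.reindex[OF inj] u)
  also have "\<dots> = 0"
    using eq by (simp add: lincomb_def complex_vector.scale_left_diff_distrib sum_subtractf)
  finally have "u (a i) = 0" if "i < d" for i
    using complex_vector.independentD[OF ind _ subset_refl] that by blast
  then have "s i = s' i" if "i < d" for i
    using that u[OF that] by (metis eq_iff_diff_eq_0 of_real_eq_0_iff)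
  then show "s = s'" using s by (metis extensionalityI lessThan_iff)
qed

lemma lincomb_image_box_param: "lincomb d a ` box_param d t = I_alg d a t"
proof (intro equalityI subsetI)
  fix x assume "x \<in> I_alg d a t"
  then obtain s where s: "x = lincomb d a s" "\<forall>i<d. 0 \<le> s i \<and> s i \<le> t i"
    by (auto simp: I_alg_def)
  then have "x = lincomb d a (restrict s {..<d})" "restrict s {..<d} \<in> box_param d t"
    by (auto simp: lincomb_def box_param_def)
  then show "x \<in> lincomb d a ` box_param d t" by blast
qed (auto simp: I_alg_def box_param_def PiE_def Pi_def)

lemma space_lebesgue_PiM: "space (lebesgue_PiM d) = extensional {..<d}"
  by (auto simp: lebesgue_PiM_def space_PiM PiE_def)

lemma box_param_sets_PiM: "box_param d t \<in> sets (Pi\<^sub>M {..<d} (\<lambda>_. lborel))"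
  unfolding box_param_def by (rule sets_PiM_I_finite) auto

lemma box_param_sets: "box_param d t \<in> sets (lebesgue_PiM d)"
  using box_param_sets_PiM by (simp add: lebesgue_PiM_def sets_completionI_sets)

lemma space_restrict_box:
  "space (restrict_space (lebesgue_PiM d) (box_param d t)) = box_param d t"
  by (simp add: space_restrict_space space_lebesgue_PiM box_param_def PiE_def Int_absorb2)

lemma inj_on_lincomb_box:
  assumes "cbasis d a"
  shows "inj_on (lincomb d a) (space (restrict_space (lebesgue_PiM d) (box_param d t)))"
  unfolding space_restrict_box
  by (rule inj_on_subset[OF inj_on_lincomb[OF assms]]) (auto simp: box_param_def PiE_def)

lemma space_mu_alg: "space (mu_alg d a t) = I_alg d a t"
  by (simp add: mu_alg_def space_embed_measure space_restrict_box lincomb_image_box_param)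

lemma emeasure_restrict_box:
  assumes "\<forall>i<d. 0 \<le> t i"
  shows "emeasure (restrict_space (lebesgue_PiM d) (box_param d t)) (box_param d t)
    = ennreal (\<Prod>i<d. t i)"
proof -
  interpret product_sigma_finite "\<lambda>_ :: nat. lborel :: real measure" by standard
  have "emeasure (restrict_space (lebesgue_PiM d) (box_param d t)) (box_param d t)
    = emeasure (lebesgue_PiM d) (box_param d t)"
    using box_param_sets by (subst emeasure_restrict_space) auto
  also have "\<dots> = emeasure (Pi\<^sub>M {..<d} (\<lambda>_. lborel)) (box_param d t)"
    using box_param_sets_PiM
    by (simp add: lebesgue_PiM_def emeasure_completion sets_completionI_sets)
  also have "\<dots> = (\<Prod>i<d. emeasure lborel {0..t i})"
    unfolding box_param_def by (rule emeasure_PiM) auto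
  also have "\<dots> = (\<Prod>i<d. ennreal (t i))" using assms by (intro prod.cong) auto
  also have "\<dots> = ennreal (\<Prod>i<d. t i)" using assms by (intro prod_ennreal) auto
  finally show ?thesis .
qed

lemma emeasure_mu_alg:
  assumes "cbasis d a" "\<forall>i<d. 0 \<le> t i"
  shows "emeasure (mu_alg d a t) (I_alg d a t) = ennreal (\<Prod>i<d. t i)"
  using emeasure_embed_measure_image'[OF inj_on_lincomb_box[OF assms(1)],
      of "box_param d t" t] emeasure_restrict_box[OF assms(2)]
  by (simp add: mu_alg_def lincomb_image_box_param sets_restrict_space_iff box_param_sets
      sets.Int_space_eq1)

text \<open>
  The Bochner integral of \<open>rho act\<close> over \<open>I_alg d a t\<close>; the integrand is integrable by
  \<open>integrable_rho\<close> below.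
\<close>

definition param_integral ::
  "nat \<Rightarrow> (nat \<Rightarrow> 'a::complex_algebra) \<Rightarrow> ('a \<Rightarrow> 'm::fd_complex_vector \<Rightarrow> 'm) \<Rightarrow> (nat \<Rightarrow> real) \<Rightarrow> 'm cendo"
  where "param_integral d a act t = (LINT x : I_alg d a t | mu_alg d a t. rho act x)"

lemma cendo_apply_rho:
  assumes "alg_module act"
  shows "cendo_apply (rho act x) = act x"
proof -
  interpret alg_module act by fact
  have "clinear (act x)"
    by (simp add: Vector_Spaces.linear_iff complex_vector.vector_space_axioms
        act_add_right act_scaleC_right)
  then show ?thesis by (simp add: rho_def Cendo_inverse)
qed

lemma rho_lincomb:
  assumes "alg_module act"
  shows "rho act (lincomb d a s) = (\<Sum>i<d. s i *\<^sub>R rho act (a i))"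
proof -
  interpret alg_module act by fact
  have add: "rho act (x + y) = rho act x + rho act y" for x y
    by (rule cendo_apply_inject[THEN iffD1])
      (simp add: plus_cendo.rep_eq cendo_apply_rho[OF assms] act_add_left fun_eq_iff)
  have scale: "rho act (complex_of_real r *\<^sub>C x) = r *\<^sub>R rho act x" for r x
    by (rule cendo_apply_inject[THEN iffD1])
      (simp add: scaleR_cendo.rep_eq cendo_apply_rho[OF assms] act_scaleC_left fun_eq_iff)
  have zero: "rho act 0 = 0" using add[of 0 0] by simp
  have "rho act (sum g {..<n}) = (\<Sum>i<n. rho act (g i))" for n :: nat and g
    by (induction n) (auto simp: zero add)
  then show ?thesis by (simp add: lincomb_def scale)
qed

lemma integrable_rho:
  assumes "cbasis d a" "alg_module act" "\<forall>i<d. 0 \<le> t i"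
  shows "set_integrable (mu_alg d a t) (I_alg d a t) (rho act)"
proof -
  let ?R = "restrict_space (lebesgue_PiM d) (box_param d t)"
  let ?f = "\<lambda>s. \<Sum>i<d. s i *\<^sub>R rho act (a i)"
  have "(\<lambda>s. ?f s) \<in> borel_measurable (Pi\<^sub>M {..<d} (\<lambda>_. lborel))"
    by measurable
  then have meas: "?f \<in> borel_measurable ?R"
    unfolding lebesgue_PiM_def by (intro measurable_restrict_space1 measurable_completion)
  interpret finite_measure ?R
    by (rule finite_measureI) (simp only: space_restrict_box emeasure_restrict_box[OF assms(3)], simp)
  have int: "integrable ?R ?f"
  proof (rule integrable_const_bound)
    show "AE s in ?R. norm (?f s) \<le> (\<Sum>i<d. t i * norm (rho act (a i)))"
    proof (intro AE_I2 sum_norm_le)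
      fix s i assume "s \<in> space ?R" "i \<in> {..<d}"
      then have "s i \<in> {0..t i}"
        unfolding space_restrict_box unfolding box_param_def by (rule PiE_mem)
      then show "norm (s i *\<^sub>R rho act (a i)) \<le> t i * norm (rho act (a i))"
        by (auto intro: mult_right_mono)
    qed
  qed (rule meas)
  have m: "lincomb d a \<in> measurable ?R (mu_alg d a t)"
    unfolding mu_alg_def by (rule measurable_embed_measure2'[OF inj_on_lincomb_box[OF assms(1)]])
  have "rho act \<in> borel_measurable (mu_alg d a t)"
    unfolding mu_alg_def
    by (rule measurable_embed_measure1) (use meas in \<open>simp add: rho_lincomb[OF assms(2)]\<close>)
  moreover have "mu_alg d a t = distr ?R (mu_alg d a t) (lincomb d a)"
    unfolding mu_alg_def by (rule embed_measure_eq_distr'[OF inj_on_lincomb_box[OF assms(1)]])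
  ultimately have "integrable (mu_alg d a t) (rho act)"
    using integrable_distr_eq[OF m, of "rho act"] int by (simp add: rho_lincomb[OF assms(2)])
  moreover have "integrable (mu_alg d a t) (rho act) \<longleftrightarrow>
      integrable (mu_alg d a t) (\<lambda>x. indicator (I_alg d a t) x *\<^sub>R rho act x)"
    by (rule Bochner_Integration.integrable_cong) (auto simp: space_mu_alg)
  ultimately show ?thesis by (simp add: set_integrable_def)
qed

end

theory Submission
  imports Defs
begin

text \<open>
  The integral has a closed form. Since \<open>rho\<close> is linear, integrating over the box only requires the
  first moments of Lebesgue measure on \<open>\<Prod>i<d. {0..t i}\<close>, and Fubini makes the \<open>i\<close>-th one equal to
  \<open>t i / 2\<close> times the volume. Hence the integral of \<open>rho\<close> is \<open>(\<Prod>i<d. t i) / 2\<close> times the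
  endomorphism \<open>\<Sum>i<d. t i *\<^sub>R rho (a i)\<close> (lemma \<open>param_integral_eq\<close>).

  For positive \<open>t\<close> the scalar factor is nonzero, so a linear bijection intertwines the integrals for
  all \<open>t\<close> exactly when it intertwines the endomorphisms \<open>\<Sum>i<d. t i *\<^sub>R rho (a i)\<close> for all positive \<open>t\<close>.
  These depend linearly on \<open>t\<close> and the positive vectors span \<open>\<real>\<^sup>d\<close>; comparing \<open>t = (1, \<dots>, 1)\<close>
  with the same vector increased by one in a single coordinate isolates the action of each basis
  element \<open>a i\<close>. As the \<open>a i\<close> span the algebra, intertwining them means being a module isomorphism.
\<close>

lemma has_bochner_integral_completion:
  fixes f :: "'b \<Rightarrow> 'c::{banach, second_countable_topology}"
  assumes "has_bochner_integral M f I"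
  shows "has_bochner_integral (completion M) f I"
  using assms by (auto simp: has_bochner_integral_iff integrable_completion integral_completion
      dest: borel_measurable_integrable)

text \<open>
  The coordinate function times the indicator of the box is a product of functions of one variable,
  so its integral splits into integrals over the sides: of \<open>x\<close> for the \<open>i\<close>-th side and of \<open>1\<close> for
  the others. Both integrands are written as powers of \<open>x\<close>, so that one formula covers all sides.
\<close>

lemma has_bochner_integral_box_coordinate:
  assumes "i < d" and t: "\<forall>j<d. 0 \<le> t j"
  shows "has_bochner_integral (restrict_space (lebesgue_PiM d) (box_param d t)) (\<lambda>s. s i)
    ((\<Prod>j<d. t j) / 2 * t i)"
proof -
  interpret product_sigma_finite "\<lambda>_ :: nat. lborel :: real measure" by standard
  let ?P = "Pi\<^sub>M {..<d} (\<lambda>_ :: nat. lborel :: real measure)"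
  define k :: "nat \<Rightarrow> nat" where "k j = (if j = i then 1 else 0)" for j
  define f :: "nat \<Rightarrow> real \<Rightarrow> real" where "f j x = x ^ k j * indicator {0..t j} x" for j x
  have f: "has_bochner_integral lborel (f j) (t j ^ Suc (k j) / Suc (k j))" if "j < d" for j
    using borel_integrable_atLeastAtMost[of 0 "t j" "\<lambda>x. x ^ k j"]
      integral_power[of 0 "t j" "k j"] t that
    by (simp add: has_bochner_integral_iff f_def[abs_def])
  have factors: "(\<Prod>j<d. f j (s j)) = indicator (box_param d t) s *\<^sub>R s i"
    if "s \<in> space ?P" for s
  proof -
    have "(\<Prod>j<d. s j ^ k j) = s i"
      using \<open>i < d\<close> by (simp add: k_def if_distrib cong: if_cong)
    moreover have "(\<Prod>j<d. indicator {0..t j} (s j)) = (indicator (box_param d t) s :: real)"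
    proof (cases "s \<in> box_param d t")
      case True
      then show ?thesis by (auto simp: box_param_def PiE_iff intro!: prod.neutral)
    next
      case False
      moreover have "s \<in> extensional {..<d}"
        using that by (simp add: space_PiM PiE_def)
      ultimately obtain j where "j < d" "s j \<notin> {0..t j}"
        by (auto simp: box_param_def PiE_iff)
      then show ?thesis using False by (auto intro!: prod_zero bexI[of _ j])
    qed
    ultimately show ?thesis by (simp add: f_def prod.distrib)
  qed
  have "(\<Prod>j<d. t j ^ Suc (k j) / Suc (k j)) = (\<Prod>j<d. t j) * (\<Prod>j<d. if j = i then t j / 2 else 1)"
    unfolding prod.distrib[symmetric] by (intro prod.cong) (auto simp: k_def)
  also have "\<dots> = (\<Prod>j<d. t j) / 2 * t i"
    using \<open>i < d\<close> by simp
  finally have "has_bochner_integral ?P (\<lambda>s. \<Prod>j<d. f j (s j)) ((\<Prod>j<d. t j) / 2 * t i)"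
    using f product_integrable_prod[of "{..<d}" f] product_integral_prod[of "{..<d}" f]
    by (simp add: has_bochner_integral_iff)
  then have "has_bochner_integral ?P (\<lambda>s. indicator (box_param d t) s *\<^sub>R s i)
      ((\<Prod>j<d. t j) / 2 * t i)"
    using factors by (subst (asm) has_bochner_integral_cong) auto
  then have "has_bochner_integral (lebesgue_PiM d) (\<lambda>s. indicator (box_param d t) s *\<^sub>R s i)
      ((\<Prod>j<d. t j) / 2 * t i)"
    unfolding lebesgue_PiM_def by (rule has_bochner_integral_completion)
  moreover have "box_param d t \<inter> space (lebesgue_PiM d) \<in> sets (lebesgue_PiM d)"
    using box_param_sets by auto
  ultimately show ?thesis
    by (simp add: has_bochner_integral_iff integrable_restrict_space integral_restrict_space)
qed

text \<open>
  Transporting the integral back along \<^const>\<open>lincomb\<close> turns the integrand into a linear combination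
  of the fixed endomorphisms \<open>rho act (a i)\<close> whose coefficients are the coordinates.
\<close>

lemma param_integral_eq:
  assumes "cbasis d a" "alg_module act" "\<forall>i<d. 0 \<le> t i"
  shows "param_integral d a act t = ((\<Prod>i<d. t i) / 2) *\<^sub>R (\<Sum>i<d. t i *\<^sub>R rho act (a i))"
proof -
  let ?R = "restrict_space (lebesgue_PiM d) (box_param d t)"
  have m: "lincomb d a \<in> measurable ?R (mu_alg d a t)"
    unfolding mu_alg_def by (rule measurable_embed_measure2'[OF inj_on_lincomb_box[OF assms(1)]])
  have distr: "mu_alg d a t = distr ?R (mu_alg d a t) (lincomb d a)"
    unfolding mu_alg_def by (rule embed_measure_eq_distr'[OF inj_on_lincomb_box[OF assms(1)]])
  let ?g = "\<lambda>x. indicator (I_alg d a t) x *\<^sub>R rho act x"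
  have "?g \<in> borel_measurable (mu_alg d a t)"
    using integrable_rho[OF assms] unfolding set_integrable_def by (rule borel_measurable_integrable)
  then have "param_integral d a act t = (\<integral>s. ?g (lincomb d a s) \<partial>?R)"
    unfolding param_integral_def set_lebesgue_integral_def
    by (subst distr) (rule integral_distr[OF m])
  also have "\<dots> = (\<integral>s. (\<Sum>i<d. s i *\<^sub>R rho act (a i)) \<partial>?R)"
  proof (rule Bochner_Integration.integral_cong)
    fix s assume "s \<in> space ?R"
    then have "lincomb d a s \<in> I_alg d a t"
      unfolding space_restrict_box lincomb_image_box_param[symmetric] by blast
    then show "?g (lincomb d a s) = (\<Sum>i<d. s i *\<^sub>R rho act (a i))"
      by (simp add: rho_lincomb[OF assms(2)])
  qed simp
  also have "has_bochner_integral ?R (\<lambda>s. \<Sum>i<d. s i *\<^sub>R rho act (a i))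
      (\<Sum>i<d. ((\<Prod>j<d. t j) / 2 * t i) *\<^sub>R rho act (a i))"
    using assms(3)
    by (intro has_bochner_integral_sum has_bochner_integral_scaleR_left
        has_bochner_integral_box_coordinate) auto
  then have "(\<integral>s. (\<Sum>i<d. s i *\<^sub>R rho act (a i)) \<partial>?R)
      = (\<Sum>i<d. ((\<Prod>j<d. t j) / 2 * t i) *\<^sub>R rho act (a i))"
    by (rule has_bochner_integral_integral_eq)
  also have "\<dots> = ((\<Prod>i<d. t i) / 2) *\<^sub>R (\<Sum>i<d. t i *\<^sub>R rho act (a i))"
    by (simp add: scaleR_sum_right)
  finally show ?thesis .
qed

lemma cendo_apply_param_integral:
  assumes "cbasis d a" "alg_module act" "\<forall>i<d. 0 \<le> t i"
  shows "cendo_apply (param_integral d a act t) m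
    = complex_of_real ((\<Prod>i<d. t i) / 2) *\<^sub>C act (lincomb d a t) m"
  by (simp only: param_integral_eq[OF assms] scaleR_cendo.rep_eq rho_lincomb[OF assms(2), symmetric]
      cendo_apply_rho[OF assms(2)])

lemma clinear_iff:
  "clinear h \<longleftrightarrow> (\<forall>x y. h (x + y) = h x + h y) \<and> (\<forall>c x. h (c *\<^sub>C x) = c *\<^sub>C h x)"
  by (simp add: Vector_Spaces.linear_iff complex_vector.vector_space_axioms)

text \<open>Scalars act through the multiples of the unit of the algebra.\<close>

lemma clinear_if_intertwines:
  assumes "alg_module actM" "alg_module actN"
    and add: "\<And>m m'. h (m + m') = h m + h m'"
    and act: "\<And>x m. h (actM x m) = actN x (h m)"
  shows "clinear h"
proof -
  interpret M: alg_module actM by fact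
  interpret N: alg_module actN by fact
  have "h (c *\<^sub>C m) = c *\<^sub>C h m" for c m
    using act[of "c *\<^sub>C 1" m]
    by (simp add: M.act_scaleC_left M.act_one N.act_scaleC_left N.act_one)
  then show ?thesis by (simp add: clinear_iff add)
qed

lemma intertwines_span:
  assumes "alg_module actM" "alg_module actN" "clinear h"
    and B: "\<And>b m. b \<in> B \<Longrightarrow> h (actM b m) = actN b (h m)"
    and x: "x \<in> cspan B"
  shows "h (actM x m) = actN x (h m)"
proof -
  interpret M: alg_module actM by fact
  interpret N: alg_module actN by fact
  have h: "h (u + v) = h u + h v" "h (c *\<^sub>C u) = c *\<^sub>C h u" for c u v
    using assms(3) by (auto simp: clinear_iff)
  have zero: "h 0 = 0" "actM 0 v = 0" "actN 0 w = 0" for v w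
    using h(1)[of 0 0] M.act_add_left[of 0 0 v] N.act_add_left[of 0 0 w] by simp_all
  show ?thesis
    using x
    by (induction rule: complex_vector.span_induct_alt)
      (simp_all add: zero h B M.act_add_left N.act_add_left M.act_scaleC_left N.act_scaleC_left)
qed

lemma lincomb_increment:
  assumes "i < d"
  shows "lincomb d a (\<lambda>j. s j + (if j = i then 1 else 0)) = lincomb d a s + a i"
proof -
  have "(\<Sum>j<d. complex_of_real (if j = i then 1 else 0) *\<^sub>C a j) = (\<Sum>j<d. if j = i then a j else 0)"
    by (intro sum.cong) (auto simp: scaleC_one)
  then show ?thesis
    using assms by (simp add: lincomb_def scaleC_add_left sum.distrib)
qed

theorem theorem3:
  fixes d :: nat
    and a :: "nat \<Rightarrow> 'a::complex_algebra"
    and actM :: "'a \<Rightarrow> 'm::fd_complex_vector \<Rightarrow> 'm"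
    and actN :: "'a \<Rightarrow> 'n::fd_complex_vector \<Rightarrow> 'n"
  assumes "cbasis d a"
    and "alg_module actM"
    and "alg_module actN"
  shows "isomorphic_modules actM actN \<longleftrightarrow>
    (\<exists>h :: 'm \<Rightarrow> 'n. clinear h \<and> bij h \<and>
      (\<forall>t :: nat \<Rightarrow> real. (\<forall>i<d. 0 < t i) \<longrightarrow>
        cendo_apply (param_integral d a actN t) \<circ> h = h \<circ> cendo_apply (param_integral d a actM t)))"
proof -
  interpret M: alg_module actM by fact
  interpret N: alg_module actN by fact
  have integrals: "cendo_apply (param_integral d a actN t) \<circ> h = h \<circ> cendo_apply (param_integral d a actM t)
      \<longleftrightarrow> (\<forall>m. h (actM (lincomb d a t) m) = actN (lincomb d a t) (h m))"
    if h: "clinear h" and t: "\<forall>i<d. 0 < t i" for h :: "'m \<Rightarrow> 'n" and t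
  proof -
    have "(\<Prod>i<d. t i) / 2 \<noteq> 0"
      using t by auto
    moreover have "\<forall>i<d. 0 \<le> t i"
      using t by (auto intro: less_imp_le)
    ultimately show ?thesis
      using h
      by (auto simp: fun_eq_iff cendo_apply_param_integral[OF assms(1,2)] cendo_apply_param_integral[OF assms(1,3)]
          clinear_iff complex_vector.scale_left_imp_eq simp del: of_real_divide of_real_prod)
  qed
  show ?thesis
  proof
    assume "isomorphic_modules actM actN"
    then obtain h where h: "bij h" "\<And>m m'. h (m + m') = h m + h m'"
      "\<And>x m. h (actM x m) = actN x (h m)"
      unfolding isomorphic_modules_def by blast
    have "clinear h"
      using clinear_if_intertwines[OF assms(2,3)] h(2,3) by blast
    then show "\<exists>h :: 'm \<Rightarrow> 'n. clinear h \<and> bij h \<and> (\<forall>t :: nat \<Rightarrow> real. (\<forall>i<d. 0 < t i) \<longrightarrow>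
        cendo_apply (param_integral d a actN t) \<circ> h = h \<circ> cendo_apply (param_integral d a actM t))"
      using h integrals by blast
  next
    assume "\<exists>h :: 'm \<Rightarrow> 'n. clinear h \<and> bij h \<and> (\<forall>t :: nat \<Rightarrow> real. (\<forall>i<d. 0 < t i) \<longrightarrow>
        cendo_apply (param_integral d a actN t) \<circ> h = h \<circ> cendo_apply (param_integral d a actM t))"
    then obtain h :: "'m \<Rightarrow> 'n" where h: "clinear h" "bij h"
      and "\<And>t :: nat \<Rightarrow> real. \<forall>i<d. 0 < t i \<Longrightarrow>
        cendo_apply (param_integral d a actN t) \<circ> h = h \<circ> cendo_apply (param_integral d a actM t)"
      by blast
    then have comb: "h (actM (lincomb d a t) m) = actN (lincomb d a t) (h m)"
      if "\<forall>i<d. 0 < t i" for t m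
      using integrals that by blast
    have add: "h (u + v) = h u + h v" for u v
      using h(1) by (simp add: clinear_iff)
    have basis: "h (actM (a i) m) = actN (a i) (h m)" if "i < d" for i m
      using comb[of "\<lambda>j. 1 + (if j = i then 1 else 0)" m] comb[of "\<lambda>_. 1" m]
      by (simp add: lincomb_increment[OF that] M.act_add_left N.act_add_left add)
    have "h (actM x m) = actN x (h m)" for x m
    proof (rule intertwines_span[OF assms(2,3) h(1)])
      show "x \<in> cspan (a ` {..<d})"
        using assms(1) by (simp add: cbasis_def)
    qed (use basis in blast)
    then show "isomorphic_modules actM actN"
      unfolding isomorphic_modules_def using h(2) add by blast
  qed
qed

end
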